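(* Let $\mathcal{P}=\{x\in\mathbb{R}^n\mid Ax\le b\}$ be a polyhedron with $\mathcal{A}(\mathcal{P})=\mathbb{R}^n$, where the system $Ax\le b$ is irredundant. Let $p\notin\mathcal{P}$, let $e_0\in\mathcal{P}$ be $p$-visible, and let $\mathcal{E}$ be a codimension-$1$ enumeration scheme for $\mathcal{P}$. Then the algorithm described in the context, run with input $\mathcal{P},p,e_0,\mathcal{E}$, completes in at most finitely many steps.
   Context: Conventions. Distances and projections are Euclidean; $\mathcal{A}(X)$ is the affine hull of $X$; faces are nonempty. A point $e\in\mathcal{P}$ is $p$-visible if no point of $\mathcal{P}$ lies on the open segment $(e,p)$. $(A\mid b)$ denotes the finite set of rows of the augmented matrix $[A\mid b]$, and $(A'\mid b')\subset(A\mid b)$ denotes a subset of these rows (a subsystem). A subsystem $(A'\mid b')$ represents a proper face $K$ of $\mathcal{P}$ (or its affine hull) if $\mathcal{A}(K)=\{x\in\mathbb{R}^n\mid A'x=b'\}$. $\mathcal{S}(K)$ is the maximal subsystem representing $K$; equivalently it is the set of all rows $(a_i\mid b_i)$ of $(A\mid b)$ with $a_ix=b_i$ for all $x\in K$. For $e\in\mathcal{P}$, $K_e$ is the smallest face of $\mathcal{P}$ containing $e$; $\mathcal{S}(K_e)$ is the set of all rows $(a_i\mid b_i)$ of $(A\mid b)$ with $a_ie=b_i$. Codimension-$1$ enumeration scheme. For a proper face $K$ of $\mathcal{P}$ let $\mathcal{F}_1(K)$ be the set of proper faces $F$ of $\mathcal{P}$ with $K\subset F$ and $\dim F-\dim K=1$.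 A codimension-$1$ enumeration scheme $\mathcal{E}$ for $\mathcal{P}$ assigns to each proper face $K$ a finite sequence $\mathcal{E}_{K,0},\dots,\mathcal{E}_{K,|\mathcal{E}_K|-1}$ of subsystems $\mathcal{E}_{K,i}\subset\mathcal{S}(K)$ such that for each $F\in\mathcal{F}_1(K)$ some $\mathcal{E}_{K,i}$ represents $\mathcal{A}(F)$. Write $\mathcal{E}_{e,i}=\mathcal{E}_{K_e,i}$ and $|\mathcal{E}_e|=|\mathcal{E}_{K_e}|$. Procedure ESC. For a subsystem $(\hat A\mid\hat b)\subset(A\mid b)$ and $e\in\mathcal{P}$ with $\hat Ae=\hat b$, set $\pi_p=p-\hat A^+\hat A(p-e)$, where $\hat A^+$ is the Moore–Penrose pseudoinverse (so $\pi_p$ is the orthogonal projection of $p$ onto $\{x\mid\hat Ax=\hat b\}$; for an empty subsystem $\pi_p=p$), set $t_0=\max\{t\in[0,1]\mid e+t(\pi_p-e)\in\mathcal{P}\}$, and define $\mathrm{ESC}(\hat A,e)=e+t_0(\pi_p-e)$. Algorithm. Initialize $(\hat A\mid\hat b)\leftarrow\mathcal{S}(K_{e_0})$ and $done\leftarrow$ false. While not $done$, do the following: 1. Set $done\leftarrow$ true and $e_0'\leftarrow\mathrm{ESC}(\hat A,e_0)$. 2. If $e_0'\ne e_0$: set $(\hat A\mid\hat b)\leftarrow\mathcal{S}(K_{e_0'})$, $e_0\leftarrow e_0'$, $done\leftarrow$ false. 3. Otherwise, if $\mathrm{rank}(\hat A)>1$: for $i=0,\dots,|\mathcal{E}_{e_0}|-1$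 in order, as long as $done$ is true, set $(\bar A\mid\bar b)\leftarrow\mathcal{E}_{e_0,i}$ and $e_0'\leftarrow\mathrm{ESC}(\bar A,e_0)$; if $e_0'\neq e_0$, set $(\hat A\mid\hat b)\leftarrow\mathcal{S}(K_{e_0'})$, $e_0\leftarrow e_0'$, $done\leftarrow$ false (which ends the for-loop). The algorithm completes when the while-loop exits, i.e. when an iteration of the while-loop ends with $done$ true. *)

theory Defs
  imports "HOL-Analysis.Analysis" "HOL-Library.While_Combinator"
begin

definition poly_of :: "real^'n^'m \<Rightarrow> real^'m \<Rightarrow> (real^'n) set" where
  "poly_of A b = {x. A *v x \<le> b}"

definition irredundant :: "real^'n^'m \<Rightarrow> real^'m \<Rightarrow> bool" where
  "irredundant A b \<longleftrightarrow> (\<forall>i. {x. \<forall>j. j \<noteq> i \<longrightarrow> (A *v x) $ j \<le> b $ j} \<noteq> poly_of A b)"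

definition visible :: "(real^'n) set \<Rightarrow> real^'n \<Rightarrow> real^'n \<Rightarrow> bool" where
  "visible P p e \<longleftrightarrow> e \<in> P \<and> open_segment e p \<inter> P = {}"

text \<open>
  A subsystem of \<open>(A | b)\<close> is encoded by the set \<open>I :: 'm set\<close> of the indices of its rows; in an
  irredundant system the rows are pairwise distinct, so index sets and sets of rows are the same
  thing.  The matrix of a subsystem keeps the shape of \<open>A\<close>: the rows outside \<open>I\<close> are replaced by
  zero rows.  Deleting zero rows of a matrix deletes the corresponding (zero) columns of its
  pseudoinverse, so neither the rank nor the product of the pseudoinverse with the matrix depends
  on this padding.  The empty subsystem gives the zero matrix.
\<close>

definition submat :: "real^'n^'m \<Rightarrow> 'm set \<Rightarrow> real^'n^'m" where
  "submat A I = (\<chi> i. if i \<in> I then A $ i else 0)"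

definition solutions :: "real^'n^'m \<Rightarrow> real^'m \<Rightarrow> 'm set \<Rightarrow> (real^'n) set" where
  "solutions A b I = {x. \<forall>i\<in>I. (A *v x) $ i = b $ i}"

definition represents :: "real^'n^'m \<Rightarrow> real^'m \<Rightarrow> 'm set \<Rightarrow> (real^'n) set \<Rightarrow> bool" where
  "represents A b I K \<longleftrightarrow> affine hull K = solutions A b I"

definition maxsys :: "real^'n^'m \<Rightarrow> real^'m \<Rightarrow> (real^'n) set \<Rightarrow> 'm set" where
  "maxsys A b K = {i. \<forall>x\<in>K. (A *v x) $ i = b $ i}"

definition proper_face :: "(real^'n) set \<Rightarrow> (real^'n) set \<Rightarrow> bool" where
  "proper_face K P \<longleftrightarrow> K face_of P \<and> K \<noteq> {} \<and> K \<noteq> P"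

definition min_face :: "(real^'n) set \<Rightarrow> real^'n \<Rightarrow> (real^'n) set" where
  "min_face P e = \<Inter>{F. F face_of P \<and> e \<in> F}"

definition codim1_faces :: "(real^'n) set \<Rightarrow> (real^'n) set \<Rightarrow> (real^'n) set set" where
  "codim1_faces P K = {F. proper_face F P \<and> K \<subseteq> F \<and> aff_dim F - aff_dim K = 1}"

text \<open>The values of a scheme at sets that are not proper faces are irrelevant.\<close>

definition codim1_scheme ::
    "real^'n^'m \<Rightarrow> real^'m \<Rightarrow> ((real^'n) set \<Rightarrow> 'm set list) \<Rightarrow> bool" where
  "codim1_scheme A b \<E> \<longleftrightarrow>
    (\<forall>K. proper_face K (poly_of A b) \<longrightarrow>
      (\<forall>I\<in>set (\<E> K). I \<subseteq> maxsys A b K) \<and>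
      (\<forall>F\<in>codim1_faces (poly_of A b) K. \<exists>I\<in>set (\<E> K). represents A b I F))"

definition pinv :: "real^'n^'m \<Rightarrow> real^'m^'n" where
  "pinv M = (THE X. M ** X ** M = M \<and> X ** M ** X = X \<and>
                    transpose (M ** X) = M ** X \<and> transpose (X ** M) = X ** M)"

definition target :: "real^'n^'m \<Rightarrow> real^'n \<Rightarrow> 'm set \<Rightarrow> real^'n \<Rightarrow> real^'n" where
  "target A p I e = p - (pinv (submat A I) ** submat A I) *v (p - e)"

definition ESC :: "real^'n^'m \<Rightarrow> real^'m \<Rightarrow> real^'n \<Rightarrow> 'm set \<Rightarrow> real^'n \<Rightarrow> real^'n" where
  "ESC A b p I e =
    (let d = target A p I e - e;
         t0 = (GREATEST t. t \<in> {0..1} \<and> e + t *\<^sub>R d \<in> poly_of A b)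
     in e + t0 *\<^sub>R d)"

text \<open>
  A state \<open>(I, e, done)\<close> consists of the current values of the subsystem, of the point and of the
  flag.  \<open>esc_body\<close> is one iteration of the while-loop, and the \<open>fold\<close> in it is the for-loop, whose
  iterations do nothing once the flag has been cleared.
\<close>

type_synonym ('n, 'm) esc_state = "'m set \<times> (real^'n) \<times> bool"

definition for_body :: "real^'n^'m \<Rightarrow> real^'m \<Rightarrow> real^'n \<Rightarrow>
    'm set \<Rightarrow> ('n, 'm) esc_state \<Rightarrow> ('n, 'm) esc_state" where
  "for_body A b p J = (\<lambda>(I, e, done).
    if done then
      let e' = ESC A b p J e in
      if e' \<noteq> e then (maxsys A b (min_face (poly_of A b) e'), e', False) else (I, e, True)
    else (I, e, done))"

definition esc_body :: "real^'n^'m \<Rightarrow> real^'m \<Rightarrow> real^'n \<Rightarrow> ((real^'n) set \<Rightarrow> 'm set list) \<Rightarrow>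
    ('n, 'm) esc_state \<Rightarrow> ('n, 'm) esc_state" where
  "esc_body A b p \<E> = (\<lambda>(I, e, done).
    let e' = ESC A b p I e in
    if e' \<noteq> e then (maxsys A b (min_face (poly_of A b) e'), e', False)
    else if rank (submat A I) > 1 then
      fold (for_body A b p) (\<E> (min_face (poly_of A b) e)) (I, e, True)
    else (I, e, True))"

text \<open>The result is \<open>None\<close> iff the while-loop does not terminate.\<close>

definition esc_algorithm :: "real^'n^'m \<Rightarrow> real^'m \<Rightarrow> real^'n \<Rightarrow> real^'n \<Rightarrow>
    ((real^'n) set \<Rightarrow> 'm set list) \<Rightarrow> ('n, 'm) esc_state option" where
  "esc_algorithm A b p e0 \<E> =
    while_option (\<lambda>(I, e, done). \<not> done) (esc_body A b p \<E>)
      (maxsys A b (min_face (poly_of A b) e0), e0, False)"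

end

theory Submission
  imports Defs
begin

text \<open>
  Every move of the algorithm brings the current point strictly closer to \<open>p\<close>.  A move of step 2
  either reaches the projection of \<open>p\<close> onto the solution set of the current subsystem or makes a
  further row active, and a move of step 3 starts at such a projection.  There are only finitely
  many subsystems, hence finitely many projections.  Counting the projections in the open and in
  the closed ball around \<open>p\<close> through the current point, and then the inactive rows, gives a
  lexicographic measure that decreases with every move.
\<close>

section \<open>The pseudoinverse\<close>

text \<open>The predicate under the \<open>THE\<close> of \<open>pinv\<close>, named so that
  uniqueness and existence can be treated separately.\<close>

definition penrose :: "real^'n^'m \<Rightarrow> real^'m^'n \<Rightarrow> bool" where
  "penrose M X \<longleftrightarrow> M ** X ** M = M \<and> X ** M ** X = X \<and>
     transpose (M ** X) = M ** X \<and> transpose (X ** M) = X ** M"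

text \<open>Transposing MX = (MY)(MX) swaps the two symmetric factors, which gives MX = MY; likewise
  XM = YM. Then X = XMX = YMX = YMY = Y.\<close>

lemma penrose_unique:
  assumes "penrose M X" "penrose M Y"
  shows "X = Y"
proof -
  note X = assms(1)[unfolded penrose_def] and Y = assms(2)[unfolded penrose_def]
  have "M ** X = transpose ((M ** Y) ** (M ** X))"
    using X Y by (metis matrix_mul_assoc)
  also have "\<dots> = (M ** X) ** (M ** Y)"
    using X Y by (simp only: matrix_transpose_mul[of "M ** Y"])
  also have "\<dots> = M ** Y"
    using X by (metis matrix_mul_assoc)
  finally have MX: "M ** X = M ** Y" .
  have "X ** M = transpose ((X ** M) ** (Y ** M))"
    using X Y by (metis matrix_mul_assoc)
  also have "\<dots> = (Y ** M) ** (X ** M)"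
    using X Y by (simp only: matrix_transpose_mul[of "X ** M"])
  also have "\<dots> = Y ** M"
    using X by (metis matrix_mul_assoc)
  finally have XM: "X ** M = Y ** M" .
  show ?thesis
    using X Y MX XM by (metis matrix_mul_assoc)
qed

text \<open>The orthogonal complement of the range of \<open>M\<close> lies in the kernel of
  \<open>transpose M\<close>.\<close>

lemma range_decomp:
  fixes M :: "real^'n^'m"
  obtains w z where "y = M *v w + z" "transpose M *v z = 0"
proof -
  obtain v z where v: "v \<in> span (range ((*v) M))"
    and z: "\<And>w. w \<in> span (range ((*v) M)) \<Longrightarrow> orthogonal z w" and y: "y = v + z"
    using orthogonal_subspace_decomp_exists[of "range ((*v) M)" y] by metis
  have "span (range ((*v) M)) = range ((*v) M)"
    by (simp add: linear_subspace_image)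
  then obtain w where "v = M *v w"
    using v by (elim equalityE) blast
  moreover have "transpose M *v z = 0"
  proof -
    have "(transpose M *v z) \<bullet> x = 0" for x
    proof -
      have "(transpose M *v z) \<bullet> x = z \<bullet> (M *v x)"
        by (simp add: dot_lmul_matrix vector_transpose_matrix)
      also have "\<dots> = 0"
        using z[of "M *v x"] by (auto simp: orthogonal_def span_base)
      finally show ?thesis .
    qed
    then show ?thesis
      by (metis inner_eq_zero_iff)
  qed
  ultimately show ?thesis
    using that y by blast
qed

text \<open>Split \<open>y\<close> along the range of \<open>M\<close>, then the preimage
  \<open>w\<close> along the range of \<open>transpose M\<close>; \<open>transpose M\<close> and
  \<open>M\<close> annihilate the respective remainders.\<close>

lemma normal_equation_solvable:
  fixes M :: "real^'n^'m"
  shows "\<exists>u. (transpose M ** M ** transpose M) *v u = transpose M *v y"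
proof -
  obtain w z where y: "y = M *v w + z" "transpose M *v z = 0"
    by (rule range_decomp)
  obtain u k where w: "w = transpose M *v u + k" "M *v k = 0"
    by (rule range_decomp[of w "transpose M"]) simp
  have "(transpose M ** M ** transpose M) *v u = transpose M *v y"
    by (simp add: y w matrix_vector_right_distrib matrix_vector_mul_assoc[symmetric]
        del: transpose_matrix_vector)
  then show ?thesis ..
qed

lemma penrose_exists: "\<exists>X. penrose M X"
proof -
  let ?T = "transpose M"
  obtain u where u: "\<And>y. (?T ** M ** ?T) *v u y = ?T *v y"
    using normal_equation_solvable by metis
  \<comment> \<open>\<open>u\<close> comes from a choice and is not known to be linear, so
    \<open>U\<close> collects its values on the unit vectors as columns.\<close>
  define U where "U = transpose (\<chi> j. u (axis j 1))"
  have U: "?T ** M ** ?T ** U = ?T"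
  proof -
    have "column j (?T ** M ** ?T ** U) = column j ?T" for j
    proof -
      have "U *v axis j 1 = u (axis j 1)"
        by (simp add: matrix_vector_mul_component vec_eq_iff U_def transpose_def
            column_def matrix_vector_mult_basis)
      then show ?thesis
        using u[of "axis j 1"] by (simp flip: matrix_vector_mult_basis add: matrix_vector_mul_assoc[symmetric])
    qed
    then show ?thesis
      by (simp add: column_def vec_eq_iff)
  qed
  define X where "X = ?T ** U"
  have MTX: "?T ** M ** X = ?T"
    using U by (simp add: X_def matrix_mul_assoc)
  \<comment> \<open>A Gram matrix is symmetric, so identifying this one with
    \<open>transpose (M ** X)\<close> makes \<open>M ** X\<close> symmetric. The same device serves
    for \<open>X ** M\<close> below.\<close>
  have "transpose (M ** X) ** (M ** X) = transpose X ** (?T ** M ** X)"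
    by (simp add: matrix_transpose_mul matrix_mul_assoc)
  also have "\<dots> = transpose (M ** X)"
    by (simp add: MTX matrix_transpose_mul)
  finally have sym1: "transpose (M ** X) = M ** X"
    by (metis matrix_transpose_mul transpose_transpose)
  have "M ** X ** M = transpose (?T ** M ** X)"
    using sym1 by (metis matrix_transpose_mul transpose_transpose matrix_mul_assoc)
  then have MXM: "M ** X ** M = M"
    by (simp add: MTX)
  have "transpose (X ** M) ** (X ** M) = ?T ** transpose U ** (M ** X ** M)"
    by (simp add: X_def matrix_transpose_mul matrix_mul_assoc)
  also have "\<dots> = transpose (X ** M)"
    unfolding MXM by (simp add: X_def matrix_transpose_mul matrix_mul_assoc)
  finally have sym2: "transpose (X ** M) = X ** M"
    by (metis matrix_transpose_mul transpose_transpose)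
  \<comment> \<open>As \<open>X = ?T ** U\<close>, the remaining condition follows once
    \<open>X ** M\<close> fixes \<open>?T\<close>.\<close>
  have "X ** M ** ?T = transpose (M ** X ** M)"
    using sym2 by (metis matrix_transpose_mul matrix_mul_assoc)
  then have "X ** M ** ?T = ?T"
    unfolding MXM .
  then have "X ** M ** X = X"
    by (metis X_def matrix_mul_assoc)
  then show ?thesis
    using MXM sym1 sym2 unfolding penrose_def by blast
qed

lemma penrose_pinv: "penrose M (pinv M)"
proof -
  have "\<exists>!X. penrose M X"
    using penrose_exists penrose_unique by blast
  then have "penrose M (THE X. penrose M X)"
    by (rule theI')
  then show ?thesis
    by (simp add: pinv_def penrose_def)
qed

section \<open>The projection of a point onto a subsystem\<close>

text \<open>Face-free form of S(K_x) for \<open>x\<close> in the polyhedron, see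
  \<open>maxsys_min_face\<close>.\<close>

definition active :: "real^'n^'m \<Rightarrow> real^'m \<Rightarrow> real^'n \<Rightarrow> 'm set" where
  "active A b x = {i. (A *v x) $ i = b $ i}"

lemma submat_mult_component:
  "(submat A I *v x) $ i = (if i \<in> I then (A *v x) $ i else 0)"
  by (simp add: submat_def matrix_vector_mult_def)

lemma submat_target:
  "submat A I *v target A p I e = submat A I *v e"
proof -
  let ?M = "submat A I"
  have "?M *v ((pinv ?M ** ?M) *v (p - e)) = ?M *v (p - e)"
    using penrose_pinv[of ?M]
    by (simp add: penrose_def matrix_vector_mul_assoc matrix_mul_assoc)
  then show ?thesis
    by (simp add: target_def matrix_vector_mult_diff_distrib)
qed

lemma target_row:
  "i \<in> I \<Longrightarrow> (A *v target A p I e) $ i = (A *v e) $ i"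
  using arg_cong[OF submat_target[of A I p e], of "\<lambda>v. v $ i"]
  by (simp add: submat_mult_component)

text \<open>\<open>pinv M ** M\<close> is symmetric, so it can be moved to the other factor, which
  it kills because \<open>e\<close> and its target have the same image under
  \<open>M = submat A I\<close>.\<close>

lemma target_orthogonal: "(p - target A p I e) \<bullet> (e - target A p I e) = 0"
proof -
  let ?M = "submat A I"
  let ?Q = "pinv ?M ** ?M"
  let ?d = "e - target A p I e"
  have "(p - target A p I e) \<bullet> ?d = (?Q *v (p - e)) \<bullet> ?d"
    by (simp add: target_def)
  also have "\<dots> = (p - e) \<bullet> (transpose ?Q *v ?d)"
    by (metis dot_lmul_matrix vector_transpose_matrix transpose_transpose)
  also have "transpose ?Q = ?Q"
    using penrose_pinv[of ?M] by (simp add: penrose_def)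
  also have "?Q *v ?d = pinv ?M *v (?M *v ?d)"
    by (simp add: matrix_vector_mul_assoc)
  also have "?M *v ?d = 0"
    by (simp add: matrix_vector_mult_diff_distrib submat_target)
  finally show ?thesis
    by simp
qed

definition projections :: "real^'n^'m \<Rightarrow> real^'m \<Rightarrow> real^'n \<Rightarrow> (real^'n) set" where
  "projections A b p =
     range (\<lambda>I. p - pinv (submat A I) *v (submat A I *v p - (\<chi> i. if i \<in> I then b $ i else 0)))"

lemma finite_projections: "finite (projections A b p)"
  by (simp add: projections_def)

lemma target_in_projections:
  assumes "I \<subseteq> active A b e"
  shows "target A p I e \<in> projections A b p"
proof -
  have "submat A I *v e = (\<chi> i. if i \<in> I then b $ i else 0)"
    using assms by (auto simp: vec_eq_iff submat_mult_component active_def)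
  then have "target A p I e =
      p - pinv (submat A I) *v (submat A I *v p - (\<chi> i. if i \<in> I then b $ i else 0))"
    by (simp add: target_def matrix_vector_mul_assoc[symmetric] matrix_vector_mult_diff_distrib)
  then show ?thesis
    unfolding projections_def by blast
qed

section \<open>The procedure ESC\<close>

lemma closed_poly_of: "closed (poly_of A b)"
proof -
  have "poly_of A b = (\<Inter>i. {x. (A *v x) $ i \<le> b $ i})"
    by (auto simp: poly_of_def less_eq_vec_def)
  moreover have "closed {x. (A *v x) $ i \<le> b $ i}" for i
    by (intro closed_Collect_le continuous_intros)
  ultimately show ?thesis
    by auto
qed

lemma convex_poly_of: "convex (poly_of A b)"
proof -
  have "poly_of A b = (\<Inter>i. {x. A $ i \<bullet> x \<le> b $ i})"
    by (auto simp: poly_of_def less_eq_vec_def matrix_vector_mul_component)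
  then show ?thesis
    by (auto intro: convex_INT convex_halfspace_le)
qed

text \<open>The admissible parameters form a compact set containing 0, so the
  \<open>GREATEST\<close> in \<open>ESC\<close> denotes an attained maximum.\<close>

lemma ESC_step:
  assumes "e \<in> poly_of A b"
  obtains t where "0 \<le> t" "t \<le> 1" "ESC A b p I e = e + t *\<^sub>R (target A p I e - e)"
    "ESC A b p I e \<in> poly_of A b"
    "\<And>s. \<lbrakk>0 \<le> s; s \<le> 1; e + s *\<^sub>R (target A p I e - e) \<in> poly_of A b\<rbrakk> \<Longrightarrow> s \<le> t"
proof -
  define d where "d = target A p I e - e"
  define S where "S = {t. t \<in> {0..1} \<and> e + t *\<^sub>R d \<in> poly_of A b}"
  have "S = {0..1} \<inter> (\<lambda>t. e + t *\<^sub>R d) -` poly_of A b"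
    by (auto simp: S_def)
  moreover have "closed ((\<lambda>t. e + t *\<^sub>R d) -` poly_of A b)"
    by (intro continuous_closed_vimage closed_poly_of) (intro continuous_intros)
  ultimately have "compact S"
    by (simp add: compact_Int_closed)
  moreover have "0 \<in> S"
    using assms by (simp add: S_def)
  ultimately obtain t where t: "t \<in> S" "\<And>s. s \<in> S \<Longrightarrow> s \<le> t"
    using compact_attains_sup[of S] by blast
  have "(GREATEST t. t \<in> {0..1} \<and> e + t *\<^sub>R d \<in> poly_of A b) = t"
    using t by (intro Greatest_equality) (auto simp: S_def)
  then have "ESC A b p I e = e + t *\<^sub>R d"
    unfolding ESC_def Let_def d_def by simp
  with t show ?thesis
    by (intro that[of t]) (auto simp: S_def d_def)
qed

lemma ESC_in_poly_of: "e \<in> poly_of A b \<Longrightarrow> ESC A b p I e \<in> poly_of A b"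
  by (metis ESC_step)

text \<open>The triangle \<open>p\<close>, \<open>c\<close>, \<open>e\<close> has a right angle at
  the target \<open>c\<close>, so moving from \<open>e\<close> along the leg towards
  \<open>c\<close> shortens the distance to \<open>p\<close> by Pythagoras.\<close>

lemma ESC_closer:
  assumes "e \<in> poly_of A b" and moved: "ESC A b p I e \<noteq> e"
  shows "dist p (ESC A b p I e) < dist p e"
proof -
  define c where "c = target A p I e"
  obtain t where t: "0 \<le> t" "t \<le> 1" "ESC A b p I e = e + t *\<^sub>R (c - e)"
    unfolding c_def using ESC_step[OF assms(1)] by metis
  have "t \<noteq> 0" "e \<noteq> c"
    using t moved by auto
  then have "0 < t" and pos: "0 < (norm (e - c))\<^sup>2"
    using t by auto
  have pyth: "(norm (p - (c + s *\<^sub>R (e - c))))\<^sup>2 = (norm (p - c))\<^sup>2 + s\<^sup>2 * (norm (e - c))\<^sup>2" for s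
  proof -
    have "orthogonal (p - c) (- (s *\<^sub>R (e - c)))"
      using target_orthogonal[of p A I e] by (simp add: orthogonal_def c_def)
    from norm_add_Pythagorean[OF this]
    have "(norm (p - c - s *\<^sub>R (e - c)))\<^sup>2 = (norm (p - c))\<^sup>2 + s\<^sup>2 * (norm (e - c))\<^sup>2"
      by (simp add: power_mult_distrib)
    then show ?thesis
      by (simp add: diff_diff_add)
  qed
  have "ESC A b p I e = c + (1 - t) *\<^sub>R (e - c)"
    by (simp add: t algebra_simps)
  then have "(dist p (ESC A b p I e))\<^sup>2 = (norm (p - c))\<^sup>2 + (1 - t)\<^sup>2 * (norm (e - c))\<^sup>2"
    by (simp only: dist_norm pyth)
  also have "\<dots> < (norm (p - c))\<^sup>2 + 1\<^sup>2 * (norm (e - c))\<^sup>2"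
    using \<open>0 < t\<close> \<open>t \<le> 1\<close> pos by (simp add: power_less_one_iff abs_square_less_1)
  also have "\<dots> = (dist p e)\<^sup>2"
    using pyth[of 1] by (simp add: dist_norm)
  finally show ?thesis
    by (rule power_less_imp_less_base) simp
qed

text \<open>Tight rows stay tight along \<open>d\<close>, and the finitely many slack rows stay
  slack for small \<open>s\<close> by continuity.\<close>

lemma poly_of_feasible_direction:
  assumes x: "x \<in> poly_of A b" and d: "\<And>i. i \<in> active A b x \<Longrightarrow> (A *v d) $ i = 0"
    and "0 < \<delta>"
  obtains s where "0 < s" "s < \<delta>" "x + s *\<^sub>R d \<in> poly_of A b"
proof -
  have "\<forall>\<^sub>F s in at_right 0. (A *v (x + s *\<^sub>R d)) $ i \<le> b $ i" for i
  proof (cases "i \<in> active A b x")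
    case True
    then have "(A *v (x + s *\<^sub>R d)) $ i = b $ i" for s
      using d[of i]
      by (simp add: active_def matrix_vector_right_distrib matrix_vector_mult_scaleR)
    then show ?thesis
      by simp
  next
    case False
    then have less: "(A *v x) $ i < b $ i"
      using x by (auto simp: active_def poly_of_def less_eq_vec_def order.strict_iff_order)
    have "((\<lambda>s. (A *v x) $ i + s * (A *v d) $ i) \<longlongrightarrow> (A *v x) $ i + 0 * (A *v d) $ i) (at_right 0)"
      by (intro tendsto_intros)
    then have "\<forall>\<^sub>F s in at_right 0. (A *v x) $ i + s * (A *v d) $ i < b $ i"
      using less by (intro order_tendstoD(2)) auto
    then show ?thesis
      by eventually_elim
        (simp add: matrix_vector_right_distrib matrix_vector_mult_scaleR)
  qed
  then have "\<forall>\<^sub>F s in at_right 0. \<forall>i. (A *v (x + s *\<^sub>R d)) $ i \<le> b $ i"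
    by (rule eventually_all_finite)
  moreover have "\<forall>\<^sub>F s in at_right 0. s \<in> {0<..<\<delta>}"
    using \<open>0 < \<delta>\<close> by (rule eventually_at_right_real)
  ultimately have "\<forall>\<^sub>F s in at_right 0. s \<in> {0<..<\<delta>} \<and> (\<forall>i. (A *v (x + s *\<^sub>R d)) $ i \<le> b $ i)"
    by eventually_elim auto
  then obtain s where "s \<in> {0<..<\<delta>}" "\<forall>i. (A *v (x + s *\<^sub>R d)) $ i \<le> b $ i"
    using eventually_happens'[OF trivial_limit_at_right_real] by blast
  then show ?thesis
    by (intro that[of s]) (auto simp: poly_of_def less_eq_vec_def)
qed

text \<open>Rows tight at \<open>e\<close> stay tight along the segment. If the move stops early
  without a new tight row, it could be prolonged, against the maximality of
  \<open>t\<close>.\<close>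

lemma ESC_active:
  assumes e: "e \<in> poly_of A b"
  defines "I \<equiv> active A b e"
  shows "ESC A b p I e = target A p I e \<or> active A b e \<subset> active A b (ESC A b p I e)"
proof -
  define d where "d = target A p I e - e"
  obtain t where t: "0 \<le> t" "t \<le> 1" and e': "ESC A b p I e = e + t *\<^sub>R d"
    and P: "ESC A b p I e \<in> poly_of A b"
    and max: "\<And>s. \<lbrakk>0 \<le> s; s \<le> 1; e + s *\<^sub>R d \<in> poly_of A b\<rbrakk> \<Longrightarrow> s \<le> t"
    unfolding d_def by (rule ESC_step[OF e, of p I]) blast
  have d: "(A *v d) $ i = 0" if "i \<in> active A b e" for i
    using that target_row[of i I A p e] by (simp add: d_def I_def matrix_vector_mult_diff_distrib)
  have sub: "active A b e \<subseteq> active A b (ESC A b p I e)"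
    using d by (auto simp: active_def e' matrix_vector_right_distrib matrix_vector_mult_scaleR)
  show ?thesis
  proof (cases "t = 1")
    case True
    then show ?thesis
      by (simp add: e' d_def)
  next
    case False
    have "active A b e \<noteq> active A b (ESC A b p I e)"
    proof
      assume "active A b e = active A b (ESC A b p I e)"
      then obtain s where s: "0 < s" "s < 1 - t" "ESC A b p I e + s *\<^sub>R d \<in> poly_of A b"
        using poly_of_feasible_direction[OF P, of d "1 - t"] d t False by auto
      then have "e + (t + s) *\<^sub>R d \<in> poly_of A b"
        by (simp add: e' algebra_simps)
      then show False
        using max[of "t + s"] s t by simp
    qed
    with sub show ?thesis
      by blast
  qed
qed

section \<open>Minimal faces\<close>

text \<open>A row tight at \<open>e\<close> cuts out a face through \<open>e\<close>, and this face
  contains the smallest one.\<close>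

lemma maxsys_min_face:
  assumes "e \<in> poly_of A b"
  shows "maxsys A b (min_face (poly_of A b) e) = active A b e"
proof
  show "maxsys A b (min_face (poly_of A b) e) \<subseteq> active A b e"
    by (auto simp: maxsys_def min_face_def active_def)
  show "active A b e \<subseteq> maxsys A b (min_face (poly_of A b) e)"
  proof
    fix i assume i: "i \<in> active A b e"
    let ?F = "poly_of A b \<inter> {x. A $ i \<bullet> x = b $ i}"
    have "?F face_of poly_of A b"
      by (rule face_of_Int_supporting_hyperplane_le[OF convex_poly_of])
        (auto simp: poly_of_def less_eq_vec_def matrix_vector_mul_component)
    moreover have "e \<in> ?F"
      using i assms by (simp add: active_def matrix_vector_mul_component)
    ultimately have "min_face (poly_of A b) e \<subseteq> ?F"
      unfolding min_face_def by blast
    then show "i \<in> maxsys A b (min_face (poly_of A b) e)"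
      by (auto simp: maxsys_def matrix_vector_mul_component)
  qed
qed

section \<open>Termination\<close>

text \<open>Both balls are needed: leaving a projection is seen only by the closed ball, which loses
  the old point, and reaching one only by the open ball, which loses the new point.\<close>

definition balls_measure :: "real^'n^'m \<Rightarrow> real^'m \<Rightarrow> real^'n \<Rightarrow> real^'n \<Rightarrow> nat" where
  "balls_measure A b p e =
     card (projections A b p \<inter> ball p (dist p e)) + card (projections A b p \<inter> cball p (dist p e))"

lemma balls_measure_mono:
  assumes "dist p e' < dist p e"
  shows "balls_measure A b p e' \<le> balls_measure A b p e"
  unfolding balls_measure_def
  using assms by (intro add_mono card_mono) (auto simp: finite_projections)

lemma balls_measure_less:
  assumes less: "dist p e' < dist p e"
    and "e \<in> projections A b p \<or> e' \<in> projections A b p"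
  shows "balls_measure A b p e' < balls_measure A b p e"
proof -
  let ?Q = "projections A b p"
  have fin: "finite (?Q \<inter> ball p (dist p e))" "finite (?Q \<inter> cball p (dist p e))"
    by (auto simp: finite_projections)
  have sub: "?Q \<inter> ball p (dist p e') \<subseteq> ?Q \<inter> ball p (dist p e)"
    "?Q \<inter> cball p (dist p e') \<subseteq> ?Q \<inter> cball p (dist p e)"
    using less by auto
  from assms(2) show ?thesis
  proof
    assume "e \<in> ?Q"
    then have "e \<in> ?Q \<inter> cball p (dist p e)" "e \<notin> ?Q \<inter> cball p (dist p e')"
      using less by auto
    then have "?Q \<inter> cball p (dist p e') \<subset> ?Q \<inter> cball p (dist p e)"
      using sub(2) by blast
    then show ?thesis
      unfolding balls_measure_def
      by (intro add_le_less_mono card_mono psubset_card_mono fin sub)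
  next
    assume "e' \<in> ?Q"
    then have "e' \<in> ?Q \<inter> ball p (dist p e)" "e' \<notin> ?Q \<inter> ball p (dist p e')"
      using less by auto
    then have "?Q \<inter> ball p (dist p e') \<subset> ?Q \<inter> ball p (dist p e)"
      using sub(1) by blast
    then show ?thesis
      unfolding balls_measure_def
      by (intro add_less_le_mono card_mono psubset_card_mono fin sub)
  qed
qed

lemma fold_for_body_done:
  "fold (for_body A b p) Js (I, e, False) = (I, e, False)"
  by (induction Js) (auto simp: for_body_def)

text \<open>The first \<open>J\<close> that moves the point decides the result, since the cleared
  flag freezes the state.\<close>

lemma fold_for_body_cases:
  assumes "e \<in> poly_of A b"
  shows "fold (for_body A b p) Js (I, e, True) = (I, e, True) \<or>
    (\<exists>J\<in>set Js. ESC A b p J e \<noteq> e \<and> fold (for_body A b p) Js (I, e, True) =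
       (active A b (ESC A b p J e), ESC A b p J e, False))"
proof (induction Js)
  case (Cons J Js)
  show ?case
  proof (cases "ESC A b p J e = e")
    case True
    then have "for_body A b p J (I, e, True) = (I, e, True)"
      by (simp add: for_body_def)
    with Cons.IH show ?thesis
      by auto
  next
    case False
    then have "for_body A b p J (I, e, True) =
        (active A b (ESC A b p J e), ESC A b p J e, False)"
      by (simp add: for_body_def Let_def maxsys_min_face ESC_in_poly_of assms)
    with False show ?thesis
      by (simp add: fold_for_body_done)
  qed
qed simp

text \<open>The last component lets the final iteration decrease too: it changes only the
  flag.\<close>

definition esc_order :: "real^'n^'m \<Rightarrow> real^'m \<Rightarrow> real^'n \<Rightarrow> (('n, 'm) esc_state) rel" where
  "esc_order A b p = inv_image (less_than <*lex*> less_than <*lex*> less_than)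
     (\<lambda>(I, e, done). (balls_measure A b p e, card (- active A b e), if done then 0 else 1))"

lemma wf_esc_order: "wf (esc_order A b p)"
  unfolding esc_order_def by (intro wf_inv_image wf_lex_prod wf_less_than)

lemma esc_body_cases:
  assumes e: "e \<in> poly_of A b"
  defines "I \<equiv> active A b e"
  shows "esc_body A b p \<E> (I, e, False) = (I, e, True) \<or>
    (\<exists>e'\<in>poly_of A b. esc_body A b p \<E> (I, e, False) = (active A b e', e', False) \<and>
       ((active A b e', e', False), (I, e, False)) \<in> esc_order A b p)"
proof (cases "ESC A b p I e = e")
  case True
  \<comment> \<open>Without a move no new row can become tight, so the other alternative of
    \<open>ESC_active\<close> holds.\<close>
  then have "target A p I e = e"
    using ESC_active[OF e, of p] by (auto simp: I_def)
  then have proj: "e \<in> projections A b p"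
    using target_in_projections[of I A b e p] by (simp add: I_def)
  show ?thesis
  proof (cases "rank (submat A I) > 1")
    case rank: True
    let ?Js = "\<E> (min_face (poly_of A b) e)"
    have body: "esc_body A b p \<E> (I, e, False) = fold (for_body A b p) ?Js (I, e, True)"
      using True rank by (simp add: esc_body_def)
    show ?thesis
    proof (cases "fold (for_body A b p) ?Js (I, e, True) = (I, e, True)")
      case False
      then obtain J where J: "ESC A b p J e \<noteq> e"
        "fold (for_body A b p) ?Js (I, e, True) = (active A b (ESC A b p J e), ESC A b p J e, False)"
        using fold_for_body_cases[OF e, of p ?Js I] by blast
      \<comment> \<open>The starting point \<open>e\<close> is a projection, so any \<open>J\<close>
        that moves it lowers the count.\<close>
      have "balls_measure A b p (ESC A b p J e) < balls_measure A b p e"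
        using balls_measure_less ESC_closer[OF e J(1)] proj by blast
      then show ?thesis
        using J body ESC_in_poly_of[OF e] by (auto simp: esc_order_def)
    qed (simp add: body)
  qed (simp add: esc_body_def True)
next
  case False
  define e' where "e' = ESC A b p I e"
  have P: "e' \<in> poly_of A b"
    by (simp add: e'_def ESC_in_poly_of e)
  have body: "esc_body A b p \<E> (I, e, False) = (active A b e', e', False)"
    using False P by (simp add: esc_body_def Let_def e'_def maxsys_min_face)
  have closer: "dist p e' < dist p e"
    using ESC_closer[OF e False] by (simp add: e'_def)
  have "((active A b e', e', False), (I, e, False)) \<in> esc_order A b p"
  proof (cases "e' = target A p I e")
    case True
    then have "e' \<in> projections A b p"
      using target_in_projections[of I A b e p] by (simp add: I_def)
    then show ?thesis
      using balls_measure_less[OF closer, of A b] by (simp add: esc_order_def)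
  next
    case False
    then have "active A b e \<subset> active A b e'"
      using ESC_active[OF e, of p] by (auto simp: e'_def I_def)
    then have "card (- active A b e') < card (- active A b e)"
      by (intro psubset_card_mono) auto
    \<comment> \<open>The ball count may stay the same here; then the number of inactive rows
      decides.\<close>
    then show ?thesis
      using balls_measure_mono[OF closer, of A b] by (auto simp: esc_order_def)
  qed
  with P body show ?thesis
    by blast
qed

theorem theorem1p4:
  fixes A :: "real^'n^'m" and b :: "real^'m"
    and P :: "(real^'n) set" and p e0 :: "real^'n"
    and \<E> :: "(real^'n) set \<Rightarrow> 'm set list"
  assumes "P = poly_of A b"
    and "affine hull P = UNIV"
    and "irredundant A b"
    and "p \<notin> P"
    and "visible P p e0"
    and "codim1_scheme A b \<E>"
  shows "\<exists>s. esc_algorithm A b p e0 \<E> = Some s"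
proof -
  \<comment> \<open>Keeping \<open>I\<close> equal to the full set of tight rows is what makes
    \<open>ESC_active\<close> applicable in step 2.\<close>
  let ?inv = "\<lambda>(I, e, done). e \<in> poly_of A b \<and> I = active A b e"
  have e0: "e0 \<in> poly_of A b"
    using assms(1,5) by (simp add: visible_def)
  show ?thesis
    unfolding esc_algorithm_def
  proof (rule wf_rel_while_option_Some[OF wf_esc_order, where P = ?inv])
    show "?inv (maxsys A b (min_face (poly_of A b) e0), e0, False)"
      using e0 by (simp add: maxsys_min_face)
  next
    fix s :: "('n, 'm) esc_state"
    assume "?inv s \<and> (\<lambda>(I, e, done). \<not> done) s"
    then obtain e where s: "s = (active A b e, e, False)" and e: "e \<in> poly_of A b"
      by (cases s) auto
    show "(esc_body A b p \<E> s, s) \<in> esc_order A b p"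
      using esc_body_cases[OF e, of p \<E>] by (auto simp: s esc_order_def)
  next
    fix s :: "('n, 'm) esc_state"
    assume "?inv s \<and> (\<lambda>(I, e, done). \<not> done) s"
    then obtain e where s: "s = (active A b e, e, False)" and e: "e \<in> poly_of A b"
      by (cases s) auto
    show "?inv (esc_body A b p \<E> s)"
      using esc_body_cases[OF e, of p \<E>] e by (auto simp: s)
  qed
qed

end
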